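(* Let $\theta,\theta'\in\mathrm{Sym}^+(2,\mathbb{R})$. (i) (Squared Hellinger divergence) For $f(u)=(\sqrt u-1)^2/2$, $$D_f[p_\theta:p_{\theta'}]=1-\frac{2|\theta|^{1/4}|\theta'|^{1/4}\exp\left(|\theta|^{1/2}+|\theta'|^{1/2}\right)}{|\theta+\theta'|^{1/2}\exp\left(|\theta+\theta'|^{1/2}\right)}.$$ (ii) (Neyman chi-squared divergence) For $f(u)=(u-1)^2$, $$D_f[p_\theta:p_{\theta'}]=\begin{cases}\dfrac{|\theta'|\exp(4|\theta'|^{1/2})}{|\theta|^{1/2}|2\theta'-\theta|^{1/2}\exp\left(2(|\theta|^{1/2}+|2\theta'-\theta|^{1/2})\right)}-1 & \text{if }2\theta'-\theta\in\mathrm{Sym}^+(2,\mathbb{R}),\\ +\infty&\text{otherwise.}\end{cases}$$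
   Context: $\mathbb{H}=\{(x,y)\in\mathbb{R}^2: y>0\}$. $\mathrm{Sym}^+(2,\mathbb{R})$ is the set of real symmetric positive-definite $2\times2$ matrices; $|\cdot|$ denotes the determinant of a matrix. For $\theta=\begin{bmatrix} a & b \\ b & c \end{bmatrix}\in\mathrm{Sym}^+(2,\mathbb{R})$, the Poincaré distribution $p_\theta$ is the probability distribution on $\mathbb{H}$ with density (with respect to $dx\,dy$) $$p_\theta(x,y)=\frac{\sqrt{|\theta|}\,e^{2\sqrt{|\theta|}}}{\pi}\exp\left(-\frac{a(x^2+y^2)+2bx+c}{y}\right)\frac1{y^2}.$$ The $f$-divergence between densities $p,q$ on $\mathbb{H}$ is $D_f[p:q]=\int_{\mathbb{H}}p\,f(q/p)\,dx\,dy$. *)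

theory Defs
  imports "HOL-Analysis.Analysis"
begin

definition upper_half_plane :: "(real \<times> real) set" where
  "upper_half_plane = {(x, y). y > 0}"

definition sym_pos_def :: "(real ^ 'n ^ 'n) set" where
  "sym_pos_def = {A. transpose A = A \<and> (\<forall>v. v \<noteq> 0 \<longrightarrow> v \<bullet> (A *v v) > 0)}"

(* Only meant for arguments in the upper half-plane; the value elsewhere plays no role. *)
definition poincare_density :: "real ^ 2 ^ 2 \<Rightarrow> real \<times> real \<Rightarrow> real" where
  "poincare_density \<theta> = (\<lambda>(x, y).
     sqrt (det \<theta>) * exp (2 * sqrt (det \<theta>)) / pi
     * exp (- ((\<theta> $ 1 $ 1 * (x\<^sup>2 + y\<^sup>2) + 2 * \<theta> $ 1 $ 2 * x + \<theta> $ 2 $ 2) / y))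
     * (1 / y\<^sup>2))"

(* The extended-real Lebesgue integral of p * f (q / p), as the difference of the integrals of
   its positive and negative parts (ennreal maps negative reals to 0).  It is defined so that a
   divergent integral has the value \<infinity>.  For convex f and probability densities p, q the
   negative part has a finite integral; for nonnegative f it vanishes. *)
definition f_divergence ::
    "(real \<Rightarrow> real) \<Rightarrow> (real \<times> real \<Rightarrow> real) \<Rightarrow> (real \<times> real \<Rightarrow> real) \<Rightarrow> ereal" where
  "f_divergence f p q =
     enn2ereal (\<integral>\<^sup>+z\<in>upper_half_plane. ennreal (p z * f (q z / p z)) \<partial>lborel)
     - enn2ereal (\<integral>\<^sup>+z\<in>upper_half_plane. ennreal (- (p z * f (q z / p z))) \<partial>lborel)"

end

theory Submission
  imports Defs "HOL-Probability.Probability" "HOL-Real_Asymp.Real_Asymp"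
begin

text \<open>Both the geometric mean \<open>sqrt (p * q)\<close> and the quotient \<open>q\<^sup>2 / p\<close> of two Poincare
  densities are multiples of a kernel of the same exponential family, with matrix \<open>(\<theta> + \<theta>') / 2\<close> and
  \<open>2 \<theta>' - \<theta>\<close> respectively, so everything reduces to integrating such a kernel for a symmetric
  matrix. With \<open>d\<close> the determinant, the Gaussian integral in \<open>x\<close> leaves the integral of
  \<open>exp (- (a y + d / (a y))) / y powr (3/2)\<close> over \<open>y > 0\<close>, which has an explicit antiderivative in
  terms of the error function.\<close>

section \<open>One-dimensional Gaussian and inverse Gaussian integrals\<close>

text \<open>The function is \<open>sqrt pi / 2\<close> times the error function. The limit at the
  top is the half-line Gaussian moment; the limit at the bottom follows because the antiderivative
  vanishing at 0 is odd.\<close>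

lemma gaussian_antiderivative:
  obtains \<Phi> :: "real \<Rightarrow> real"
  where "\<And>x. (\<Phi> has_real_derivative exp (- x\<^sup>2)) (at x)"
    and "(\<Phi> \<longlongrightarrow> sqrt pi / 2) at_top"
    and "(\<Phi> \<longlongrightarrow> - (sqrt pi / 2)) at_bot"
proof -
  obtain F :: "real \<Rightarrow> real" where "\<And>x. (F has_vector_derivative exp (- x\<^sup>2)) (at x)"
    using einterval_antiderivative[of "-\<infinity>" "\<infinity>" "\<lambda>x. exp (- x\<^sup>2) :: real"] by auto
  then have F: "(F has_real_derivative exp (- x\<^sup>2)) (at x)" for x
    by (simp add: has_real_derivative_iff_has_vector_derivative)
  define \<Phi> where "\<Phi> x = F x - F 0" for x
  have deriv: "(\<Phi> has_real_derivative exp (- x\<^sup>2)) (at x)" for x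
    unfolding \<Phi>_def by (auto intro!: derivative_eq_intros F)
  have odd: "\<Phi> (- x) = - \<Phi> x" for x
  proof -
    \<comment> \<open>Oddness by differentiation: as \<open>exp (- x\<^sup>2)\<close> is even, the
      sum is constant, and it vanishes at 0.\<close>
    have "((\<lambda>x. \<Phi> x + \<Phi> (- x)) has_real_derivative 0) (at x)" for x
      by (auto intro!: derivative_eq_intros deriv DERIV_chain2[OF deriv])
    then have "\<Phi> x + \<Phi> (- x) = \<Phi> 0 + \<Phi> (- 0)"
      by (intro DERIV_isconst_all) blast
    then show ?thesis by (simp add: \<Phi>_def)
  qed
  let ?g = "\<lambda>x. indicator {0..} x *\<^sub>R exp (- x\<^sup>2) :: real"
  have int: "integrable lborel ?g" "integral\<^sup>L lborel ?g = sqrt pi / 2"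
    using gaussian_moment_0 by (auto simp: has_bochner_integral_iff)
  have "((\<lambda>y. \<integral>x. indicator {..y} x *\<^sub>R ?g x \<partial>lborel) \<longlongrightarrow> sqrt pi / 2) at_top"
    using tendsto_integral_at_top[OF _ int(1)] unfolding int(2) by simp
  moreover have "eventually (\<lambda>y. (\<integral>x. indicator {..y} x *\<^sub>R ?g x \<partial>lborel) = \<Phi> y) at_top"
    using eventually_ge_at_top[of 0]
  proof eventually_elim
    case (elim y)
    have "(\<integral>x. exp (- x\<^sup>2) * indicator {0..y} x \<partial>lborel) = F y - F 0"
      by (rule integral_FTC_Icc_real[OF elim F]) auto
    moreover have "(\<lambda>x. indicator {..y} x *\<^sub>R ?g x) = (\<lambda>x. exp (- x\<^sup>2) * indicator {0..y} x)"
      by (auto split: split_indicator)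
    ultimately show ?case by (simp only: \<Phi>_def)
  qed
  ultimately have top: "(\<Phi> \<longlongrightarrow> sqrt pi / 2) at_top"
    by (rule Lim_transform_eventually)
  then have "((\<lambda>x. - \<Phi> x) \<longlongrightarrow> - (sqrt pi / 2)) at_top" by (rule tendsto_minus)
  then have "(\<Phi> \<longlongrightarrow> - (sqrt pi / 2)) at_bot"
    by (simp add: filterlim_at_bot_mirror odd)
  with deriv top that show ?thesis by blast
qed

text \<open>Put u = q / sqrt y - p sqrt y and v = q / sqrt y + p sqrt y. Then u^2 + 2pq and v^2 -
  2pq both equal p^2 y + q^2 / y, while u' + v' = - q / (y sqrt y). Hence the error functions of u
  and v, weighted by exp (-2pq) and exp (2pq), add up to an antiderivative up to the factor -q; the
  terms in p / (2 sqrt y) cancel.\<close>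

lemma nn_integral_inverse_gaussian:
  fixes p q :: real
  assumes p: "p > 0" and q: "q > 0"
  shows "(\<integral>\<^sup>+y\<in>{0<..}. ennreal (exp (- (p\<^sup>2 * y + q\<^sup>2 / y)) / (y * sqrt y)) \<partial>lborel)
    = ennreal (sqrt pi / q * exp (- 2 * p * q))"
proof -
  obtain \<Phi> :: "real \<Rightarrow> real"
    where \<Phi>: "\<And>x. (\<Phi> has_real_derivative exp (- x\<^sup>2)) (at x)"
    and top: "(\<Phi> \<longlongrightarrow> sqrt pi / 2) at_top"
    and bot: "(\<Phi> \<longlongrightarrow> - (sqrt pi / 2)) at_bot"
    using gaussian_antiderivative by blast
  let ?f = "\<lambda>y. exp (- (p\<^sup>2 * y + q\<^sup>2 / y)) / (y * sqrt y)"
  let ?u = "\<lambda>y. q / sqrt y - p * sqrt y"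
  let ?v = "\<lambda>y. q / sqrt y + p * sqrt y"
  define F where
    "F y = - (\<Phi> (?u y) * exp (- 2 * p * q) + \<Phi> (?v y) * exp (2 * p * q)) / q" for y
  have F: "(F has_real_derivative ?f y) (at y)" if y: "y > 0" for y
  proof -
    have u: "(?u has_real_derivative - (q / (2 * y * sqrt y)) - p / (2 * sqrt y)) (at y)"
      using y by (auto intro!: derivative_eq_intros simp: field_simps)
    have v: "(?v has_real_derivative - (q / (2 * y * sqrt y)) + p / (2 * sqrt y)) (at y)"
      using y by (auto intro!: derivative_eq_intros simp: field_simps)
    have "exp (- (?u y)\<^sup>2) * exp (- 2 * p * q) = exp (- (p\<^sup>2 * y + q\<^sup>2 / y))"
      using y by (simp add: power2_diff power_mult_distrib power_divide flip: exp_add)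
    moreover have "exp (- (?v y)\<^sup>2) * exp (2 * p * q) = exp (- (p\<^sup>2 * y + q\<^sup>2 / y))"
      using y by (simp add: power2_sum power_mult_distrib power_divide flip: exp_add)
    moreover have "(F has_real_derivative
      - ((exp (- (?u y)\<^sup>2) * (- (q / (2 * y * sqrt y)) - p / (2 * sqrt y))) * exp (- 2 * p * q)
         + (exp (- (?v y)\<^sup>2) * (- (q / (2 * y * sqrt y)) + p / (2 * sqrt y))) * exp (2 * p * q)) / q) (at y)"
      unfolding F_def
      by (intro DERIV_cdivide DERIV_minus DERIV_add DERIV_cmult_right DERIV_chain2[OF \<Phi>] u v)
    ultimately show ?thesis using y q
      by (elim DERIV_cong) (simp add: field_simps)
  qed
  have u0: "LIM y at_right 0. ?u y :> at_top" and v0: "LIM y at_right 0. ?v y :> at_top"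
    and u1: "LIM y at_top. ?u y :> at_bot" and v1: "LIM y at_top. ?v y :> at_top"
    using p q by real_asymp+
  \<comment> \<open>Only u changes sign between the endpoints: v tends to plus infinity at both, so
    its contributions cancel in the difference, and u contributes a jump of
    \<open>sqrt pi\<close>.\<close>
  have lim0: "((F \<circ> real_of_ereal) \<longlongrightarrow>
      - (sqrt pi / 2 * exp (- 2 * p * q) + sqrt pi / 2 * exp (2 * p * q)) / q) (at_right 0)"
    unfolding zero_ereal_def ereal_tendsto_simps F_def using q
    by (intro tendsto_intros filterlim_compose[OF top] u0 v0) auto
  have lim1: "((F \<circ> real_of_ereal) \<longlongrightarrow>
      - (- (sqrt pi / 2) * exp (- 2 * p * q) + sqrt pi / 2 * exp (2 * p * q)) / q) (at_left \<infinity>)"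
    unfolding ereal_tendsto_simps F_def using q
    by (intro tendsto_intros filterlim_compose[OF bot u1] filterlim_compose[OF top v1]) auto
  have cont: "isCont ?f y" if "y > 0" for y
    using that by (auto intro!: continuous_intros)
  \<comment> \<open>For a nonnegative integrand, the limits of the antiderivative at the endpoints
    give integrability, \<open>FTC(1)\<close>, as well as the value, \<open>FTC(2)\<close>.\<close>
  note FTC = interval_integral_FTC_nonneg[OF _ _ _ _ lim0 lim1, of ?f]
  have E: "einterval 0 \<infinity> = {0<..}" by (auto simp: einterval_def zero_ereal_def)
  have int: "set_integrable lborel {0<..} ?f"
    using FTC(1) F cont by (auto simp: E zero_ereal_def)
  have "(LBINT y=0..\<infinity>. ?f y) = sqrt pi / q * exp (- 2 * p * q)"
    using FTC(2) F cont q by (auto simp: zero_ereal_def field_simps)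
  then have val: "(LBINT y:{0<..}. ?f y) = sqrt pi / q * exp (- 2 * p * q)"
    by (simp add: interval_lebesgue_integral_def E)
  have "(\<integral>\<^sup>+y\<in>{0<..}. ennreal (?f y) \<partial>lborel)
      = (\<integral>\<^sup>+y. ennreal (indicator {0<..} y *\<^sub>R ?f y) \<partial>lborel)"
    by (intro nn_integral_cong) (auto split: split_indicator)
  also have "\<dots> = ennreal (LBINT y:{0<..}. ?f y)"
    using int unfolding set_integrable_def set_lebesgue_integral_def
    by (intro nn_integral_eq_integral) (auto split: split_indicator)
  finally show ?thesis unfolding val .
qed

text \<open>Completing the square exhibits the integrand as a multiple of the normal density with
  mean -B / A and variance 1 / (2A), whose total mass is 1.\<close>

lemma nn_integral_gaussian_quadratic:
  fixes A B C :: real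
  assumes A: "A > 0"
  shows "(\<integral>\<^sup>+x. ennreal (exp (- (A * x\<^sup>2 + 2 * B * x + C))) \<partial>lborel)
    = ennreal (sqrt (pi / A) * exp (B\<^sup>2 / A - C))"
proof -
  let ?N = "normal_density (- B / A) (1 / sqrt (2 * A))"
  let ?k = "sqrt (pi / A) * exp (B\<^sup>2 / A - C)"
  have "exp (- (A * x\<^sup>2 + 2 * B * x + C)) = ?k * ?N x" for x
  proof -
    have "- (A * x\<^sup>2 + 2 * B * x + C) = (B\<^sup>2 / A - C) + - A * (x + B / A)\<^sup>2"
      using A by (simp add: power2_eq_square field_simps)
    moreover have "?N x = sqrt (A / pi) * exp (- A * (x + B / A)\<^sup>2)"
      using A by (simp add: normal_density_def power_divide real_sqrt_divide)
    moreover have "sqrt (pi / A) * sqrt (A / pi) = 1"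
      using A by (simp flip: real_sqrt_mult)
    ultimately show ?thesis by (simp only: exp_add) (simp add: mult_ac)
  qed
  then have "(\<integral>\<^sup>+x. ennreal (exp (- (A * x\<^sup>2 + 2 * B * x + C))) \<partial>lborel)
      = (\<integral>\<^sup>+x. ennreal (?k * ?N x) \<partial>lborel)"
    by simp
  also have "\<dots> = ennreal (\<integral>x. ?k * ?N x \<partial>lborel)"
    using A by (intro nn_integral_eq_integral) auto
  also have "(\<integral>x. ?k * ?N x \<partial>lborel) = ?k"
    using A by simp
  finally show ?thesis .
qed

section \<open>The kernel and its integral over the upper half-plane\<close>

text \<open>The unnormalised density, for arbitrary real coefficients: indefinite forms must be
  allowed because the chi-squared integrand can lead to one.\<close>

definition poincare_kernel :: "real \<Rightarrow> real \<Rightarrow> real \<Rightarrow> real \<times> real \<Rightarrow> real" where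
  "poincare_kernel a b c = (\<lambda>(x, y). exp (- ((a * (x\<^sup>2 + y\<^sup>2) + 2 * b * x + c) / y)) * (1 / y\<^sup>2))"

lemma poincare_kernel_measurable [measurable]: "poincare_kernel a b c \<in> borel_measurable borel"
  unfolding poincare_kernel_def borel_prod[symmetric] by measurable

lemma upper_half_plane_measurable [measurable]: "upper_half_plane \<in> sets borel"
proof -
  have "upper_half_plane = UNIV \<times> {0<..}" by (auto simp: upper_half_plane_def)
  moreover have "open ((UNIV :: real set) \<times> {0 :: real<..})" by (intro open_Times) auto
  ultimately show ?thesis by simp
qed

text \<open>By Tonelli the x-integral can be taken first. For fixed y > 0 it is Gaussian with
  quadratic coefficient a / y, and its factor sqrt (pi y / a) turns 1 / y^2 into a multiple of
  y^(-3/2).\<close>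

lemma nn_integral_poincare_kernel_pos_def:
  assumes a: "a > 0" and d: "a * c - b\<^sup>2 > 0"
  shows "(\<integral>\<^sup>+z\<in>upper_half_plane. ennreal (poincare_kernel a b c z) \<partial>lborel)
    = ennreal (pi * exp (- 2 * sqrt (a * c - b\<^sup>2)) / sqrt (a * c - b\<^sup>2))"
proof -
  let ?d = "a * c - b\<^sup>2"
  \<comment> \<open>The inverse Gaussian integrand with p = sqrt a and q = sqrt (d / a), where d =
    ac - b^2; thus pq = sqrt d.\<close>
  let ?g = "\<lambda>y. exp (- ((sqrt a)\<^sup>2 * y + (sqrt (?d / a))\<^sup>2 / y)) / (y * sqrt y)"
  have inner: "(\<integral>\<^sup>+x. ennreal (poincare_kernel a b c (x, y)) * indicator upper_half_plane (x, y) \<partial>lborel)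
      = ennreal (sqrt (pi / a)) * (ennreal (?g y) * indicator {0<..} y)" for y
  proof (cases "y > 0")
    case True
    have "ennreal (poincare_kernel a b c (x, y)) * indicator upper_half_plane (x, y)
        = ennreal (1 / y\<^sup>2) * ennreal (exp (- ((a / y) * x\<^sup>2 + 2 * (b / y) * x + (a * y + c / y))))" for x
      using True
      by (simp add: poincare_kernel_def upper_half_plane_def ennreal_mult[symmetric] mult.commute)
        (simp add: power2_eq_square field_simps)
    then have "(\<integral>\<^sup>+x. ennreal (poincare_kernel a b c (x, y)) * indicator upper_half_plane (x, y) \<partial>lborel)
        = ennreal (1 / y\<^sup>2) * ennreal (sqrt (pi / (a / y)) * exp ((b / y)\<^sup>2 / (a / y) - (a * y + c / y)))"
      using nn_integral_gaussian_quadratic[of "a / y" "b / y" "a * y + c / y"] True a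
      by (simp only:) (subst nn_integral_cmult, simp_all)
    also have "\<dots> = ennreal (1 / y\<^sup>2 * (sqrt (pi / (a / y)) * exp ((b / y)\<^sup>2 / (a / y) - (a * y + c / y))))"
      using True a by (intro ennreal_mult[symmetric]) auto
    also have "1 / y\<^sup>2 * (sqrt (pi / (a / y)) * exp ((b / y)\<^sup>2 / (a / y) - (a * y + c / y)))
        = sqrt (pi / a) * ?g y"
    proof -
      have "(b / y)\<^sup>2 / (a / y) - (a * y + c / y) = - ((sqrt a)\<^sup>2 * y + (sqrt (?d / a))\<^sup>2 / y)"
        using True a d by (simp add: power2_eq_square field_simps)
      moreover have "1 / y\<^sup>2 * sqrt (pi / (a / y)) = sqrt (pi / a) / (y * sqrt y)"
        using True a by (simp add: real_sqrt_mult real_sqrt_divide power2_eq_square field_simps)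
      ultimately show ?thesis by (simp only: mult.assoc[symmetric]) simp
    qed
    also have "ennreal (sqrt (pi / a) * ?g y)
        = ennreal (sqrt (pi / a)) * (ennreal (?g y) * indicator {0<..} y)"
      using True a by (subst ennreal_mult) auto
    finally show ?thesis .
  qed (auto simp: upper_half_plane_def)
  have "(\<integral>\<^sup>+z\<in>upper_half_plane. ennreal (poincare_kernel a b c z) \<partial>lborel)
      = (\<integral>\<^sup>+y. (\<integral>\<^sup>+x. ennreal (poincare_kernel a b c (x, y)) * indicator upper_half_plane (x, y) \<partial>lborel) \<partial>lborel)"
    unfolding lborel_prod[symmetric]
    by (rule lborel_pair.nn_integral_snd[symmetric]) (simp add: lborel_prod)
  also have "\<dots> = ennreal (sqrt (pi / a)) * (\<integral>\<^sup>+y\<in>{0<..}. ennreal (?g y) \<partial>lborel)"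
    unfolding inner by (rule nn_integral_cmult) measurable
  also have "\<dots> = ennreal (sqrt (pi / a)) * ennreal (sqrt pi / sqrt (?d / a) * exp (- 2 * sqrt a * sqrt (?d / a)))"
    using a d by (subst nn_integral_inverse_gaussian) auto
  also have "\<dots> = ennreal (sqrt (pi / a) * (sqrt pi / sqrt (?d / a) * exp (- 2 * sqrt a * sqrt (?d / a))))"
    using a d by (intro ennreal_mult[symmetric]) auto
  also have "sqrt (pi / a) * (sqrt pi / sqrt (?d / a) * exp (- 2 * sqrt a * sqrt (?d / a)))
      = pi * exp (- 2 * sqrt ?d) / sqrt ?d"
  proof -
    have "sqrt a * sqrt (?d / a) = sqrt ?d"
      using a by (simp flip: real_sqrt_mult)
    then have "- 2 * sqrt a * sqrt (?d / a) = - 2 * sqrt ?d" by simp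
    moreover have "sqrt (pi / a) * (sqrt pi / sqrt (?d / a)) = pi / sqrt ?d"
      using a by (simp add: real_sqrt_divide)
    ultimately show ?thesis by (simp only: mult.assoc[symmetric]) simp
  qed
  finally show ?thesis .
qed

text \<open>Increasing the diagonal decreases the kernel, and the diagonal can be increased to reach
  any prescribed positive determinant; the integral over the positive definite matrices blows up
  as the determinant tends to 0.\<close>

lemma nn_integral_poincare_kernel_not_pos_def:
  assumes "\<not> (a > 0 \<and> a * c - b\<^sup>2 > 0)"
  shows "(\<integral>\<^sup>+z\<in>upper_half_plane. ennreal (poincare_kernel a b c z) \<partial>lborel) = \<infinity>"
    (is "?I = _")
proof -
  have bound: "ennreal (pi * exp (- 2 * s) / s) \<le> ?I" if s: "s > 0" for s
  proof -
    \<comment> \<open>If a > 0, then ac - b^2 is not positive, so it suffices to keep a and raise c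
      to (b^2 + s^2) / a. If a is not positive, c is replaced by \<open>max c 1\<close> to make it
      positive; the determinant condition then forces a positive a', which exceeds a.\<close>
    obtain a' c' where *: "a \<le> a'" "c \<le> c'" "a' > 0" "a' * c' - b\<^sup>2 = s\<^sup>2"
    proof (cases "a > 0")
      case True
      with assms have "a * c \<le> b\<^sup>2 + s\<^sup>2" using s by (smt (verit) zero_le_power2)
      with True show ?thesis by (intro that[of a "(b\<^sup>2 + s\<^sup>2) / a"]) (auto simp: field_simps)
    next
      case False
      have pos: "(b\<^sup>2 + s\<^sup>2) / max c 1 > 0"
        using s by (intro divide_pos_pos) (auto intro: add_nonneg_pos)
      with False show ?thesis
        by (intro that[of "(b\<^sup>2 + s\<^sup>2) / max c 1" "max c 1"]) auto
    qed
    have "ennreal (pi * exp (- 2 * s) / s)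
        = (\<integral>\<^sup>+z\<in>upper_half_plane. ennreal (poincare_kernel a' b c' z) \<partial>lborel)"
      using *(3,4) s by (subst nn_integral_poincare_kernel_pos_def) auto
    also have "\<dots> \<le> ?I"
      using *(1,2)
      by (intro nn_integral_mono)
        (auto simp: poincare_kernel_def upper_half_plane_def split: split_indicator
          intro!: ennreal_leI mult_right_mono divide_right_mono add_mono)
    finally show ?thesis .
  qed
  show ?thesis
  proof (rule ccontr)
    assume "?I \<noteq> \<infinity>"
    then obtain r where r: "r \<ge> 0" "?I = ennreal r" by (cases ?I) auto
    have "pi * exp (- 2 * s) / s \<le> r" if "s > 0" for s
      using bound[OF that] that r by (simp add: ennreal_le_iff)
    then have "eventually (\<lambda>s. pi * exp (- 2 * s) / s \<le> r) (at_right 0)"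
      by (auto simp: eventually_at_filter)
    moreover have "LIM s at_right 0. pi * exp (- 2 * s) / s :> at_top"
      by real_asymp
    then have "eventually (\<lambda>s. pi * exp (- 2 * s) / s > r) (at_right 0)"
      by (simp add: filterlim_at_top_dense)
    ultimately have "eventually (\<lambda>s::real. False) (at_right 0)"
      by eventually_elim simp
    then show False by simp
  qed
qed

section \<open>Positive definite matrices and the Poincare densities\<close>

text \<open>Sylvester's criterion in dimension 2. It translates positive definiteness into the
  condition on a, b, c that decides whether the kernel integral is finite.\<close>

lemma sym_pos_def_2_iff:
  fixes M :: "real ^ 2 ^ 2"
  shows "M \<in> sym_pos_def \<longleftrightarrow> M $ 1 $ 2 = M $ 2 $ 1 \<and> M $ 1 $ 1 > 0 \<and> det M > 0"
proof -
  let ?a = "M $ 1 $ 1" and ?b = "M $ 1 $ 2" and ?c = "M $ 2 $ 2"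
  have sym: "transpose M = M \<longleftrightarrow> ?b = M $ 2 $ 1"
    by (auto simp: vec_eq_iff forall_2 transpose_def)
  have form: "v \<bullet> (M *v v) = ?a * (v $ 1)\<^sup>2 + 2 * ?b * v $ 1 * v $ 2 + ?c * (v $ 2)\<^sup>2"
    if "?b = M $ 2 $ 1" for v
    using that
    by (simp add: inner_vec_def matrix_vector_mult_def sum_2 power2_eq_square algebra_simps)
  have det: "det M = ?a * ?c - ?b\<^sup>2" if "?b = M $ 2 $ 1"
    using that by (simp add: det_2 power2_eq_square)
  show ?thesis
  proof (intro iffI conjI)
    assume M: "M \<in> sym_pos_def"
    then show s: "?b = M $ 2 $ 1" by (simp add: sym_pos_def_def sym)
    have pos: "?a * (v $ 1)\<^sup>2 + 2 * ?b * v $ 1 * v $ 2 + ?c * (v $ 2)\<^sup>2 > 0" if "v \<noteq> 0" for v :: "real ^ 2"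
      using M that by (simp add: sym_pos_def_def form[OF s, symmetric])
    show a: "?a > 0"
      using pos[of "vector [1, 0]"] by (simp add: vec_eq_iff forall_2)
    \<comment> \<open>The vector (-b, a) is orthogonal to the first row (a, b), so the quadratic
      form takes there the value a times the determinant.\<close>
    have "?a * (?a * ?c - ?b\<^sup>2) > 0"
      using pos[of "vector [- ?b, ?a]"] a
      by (simp add: vec_eq_iff forall_2 power2_eq_square algebra_simps)
    with a show "det M > 0" by (simp add: det[OF s] zero_less_mult_iff)
  next
    assume *: "?b = M $ 2 $ 1 \<and> ?a > 0 \<and> det M > 0"
    then have s: "?b = M $ 2 $ 1" and a: "?a > 0" and d: "?a * ?c - ?b\<^sup>2 > 0"
      by (auto simp: det)
    have "v \<bullet> (M *v v) > 0" if v: "v \<noteq> 0" for v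
    proof -
      \<comment> \<open>Multiplying by a completes the square without division. If the second
        coordinate of v vanishes, the first does not, and the square is positive; otherwise the
        determinant term is.\<close>
      have "?a * (v \<bullet> (M *v v)) = (?a * v $ 1 + ?b * v $ 2)\<^sup>2 + (?a * ?c - ?b\<^sup>2) * (v $ 2)\<^sup>2"
        by (simp add: form[OF s] power2_eq_square algebra_simps)
      also have "\<dots> > 0"
      proof (cases "v $ 2 = 0")
        case True
        with v a show ?thesis by (auto simp: vec_eq_iff forall_2)
      next
        case False
        with d show ?thesis by (intro add_nonneg_pos) auto
      qed
      finally show ?thesis using a by (simp add: zero_less_mult_iff)
    qed
    with s show "M \<in> sym_pos_def" by (simp add: sym_pos_def_def sym)
  qed
qed

definition matrix_kernel :: "real ^ 2 ^ 2 \<Rightarrow> real \<times> real \<Rightarrow> real" where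
  "matrix_kernel M = poincare_kernel (M $ 1 $ 1) (M $ 1 $ 2) (M $ 2 $ 2)"

lemma matrix_kernel_measurable [measurable]: "matrix_kernel M \<in> borel_measurable borel"
  by (simp add: matrix_kernel_def)

lemma matrix_kernel_pos: "z \<in> upper_half_plane \<Longrightarrow> matrix_kernel M z > 0"
  by (auto simp: upper_half_plane_def matrix_kernel_def poincare_kernel_def)

lemma nn_integral_matrix_kernel:
  assumes "M $ 1 $ 2 = M $ 2 $ 1" and k: "k \<ge> 0"
  shows "(\<integral>\<^sup>+z\<in>upper_half_plane. ennreal (k * matrix_kernel M z) \<partial>lborel)
    = ennreal k * (if M \<in> sym_pos_def then ennreal (pi * exp (- 2 * sqrt (det M)) / sqrt (det M)) else \<infinity>)"
proof -
  have d: "det M = M $ 1 $ 1 * M $ 2 $ 2 - (M $ 1 $ 2)\<^sup>2"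
    using assms by (simp add: det_2 power2_eq_square)
  have "(\<integral>\<^sup>+z\<in>upper_half_plane. ennreal (matrix_kernel M z) \<partial>lborel)
    = (if M \<in> sym_pos_def then ennreal (pi * exp (- 2 * sqrt (det M)) / sqrt (det M)) else \<infinity>)"
    using nn_integral_poincare_kernel_pos_def[of "M $ 1 $ 1" "M $ 2 $ 2" "M $ 1 $ 2"]
      nn_integral_poincare_kernel_not_pos_def[of "M $ 1 $ 1" "M $ 2 $ 2" "M $ 1 $ 2"] assms(1)
    unfolding matrix_kernel_def sym_pos_def_2_iff d by (cases "M $ 1 $ 1 > 0 \<and> M $ 1 $ 1 * M $ 2 $ 2 - (M $ 1 $ 2)\<^sup>2 > 0") simp_all
  then show ?thesis
    using k by (simp add: ennreal_mult' mult.assoc nn_integral_cmult)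
qed

text \<open>For positive definite M this is the reciprocal of the kernel integral, so the densities
  have total mass 1.\<close>

definition poincare_normalizer :: "real ^ 2 ^ 2 \<Rightarrow> real" where
  "poincare_normalizer M = sqrt (det M) * exp (2 * sqrt (det M)) / pi"

lemma poincare_normalizer_pos: "M \<in> sym_pos_def \<Longrightarrow> poincare_normalizer M > 0"
  by (simp add: poincare_normalizer_def sym_pos_def_2_iff)

lemma poincare_density_kernel:
  "poincare_density M z = poincare_normalizer M * matrix_kernel M z"
  by (simp add: poincare_density_def poincare_normalizer_def matrix_kernel_def poincare_kernel_def split: prod.split)

lemma poincare_density_measurable [measurable]: "poincare_density M \<in> borel_measurable borel"
  unfolding poincare_density_kernel[abs_def] by measurable

lemma poincare_density_pos:
  assumes "M \<in> sym_pos_def" and "z \<in> upper_half_plane"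
  shows "poincare_density M z > 0"
  using assms by (simp add: poincare_density_kernel matrix_kernel_pos poincare_normalizer_pos)

lemma nn_integral_poincare_density:
  assumes "M \<in> sym_pos_def"
  shows "(\<integral>\<^sup>+z\<in>upper_half_plane. ennreal (poincare_density M z) \<partial>lborel) = 1"
proof -
  have d: "det M > 0" and s: "M $ 1 $ 2 = M $ 2 $ 1"
    using assms by (auto simp: sym_pos_def_2_iff)
  have "exp (2 * sqrt (det M)) * exp (- (2 * sqrt (det M))) = 1"
    by (simp flip: exp_add)
  then have "poincare_normalizer M * (pi * exp (- 2 * sqrt (det M)) / sqrt (det M)) = 1"
    using d by (simp add: poincare_normalizer_def field_simps)
  then show ?thesis
    unfolding poincare_density_kernel using d assms poincare_normalizer_pos[OF assms]
    by (subst nn_integral_matrix_kernel[OF s]) (auto simp flip: ennreal_mult)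
qed

text \<open>The exponent is linear in the matrix: a product of kernels adds the matrices and the
  root halves the sum. The factor 1 / y^2 is its own geometric mean.\<close>

lemma matrix_kernel_sqrt_mult:
  assumes "z \<in> upper_half_plane"
  shows "sqrt (matrix_kernel M z * matrix_kernel N z) = matrix_kernel ((1/2) *\<^sub>R (M + N)) z"
proof -
  have "matrix_kernel M z * matrix_kernel N z = (matrix_kernel ((1/2) *\<^sub>R (M + N)) z)\<^sup>2"
    using assms
    by (auto simp: upper_half_plane_def matrix_kernel_def poincare_kernel_def power2_eq_square exp_add[symmetric] field_simps)
  then show ?thesis using matrix_kernel_pos[OF assms, of "(1/2) *\<^sub>R (M + N)"] by simp
qed

text \<open>By the same linearity, squaring doubles the matrix and division subtracts; the powers of
  y again combine to 1 / y^2.\<close>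

lemma matrix_kernel_square_divide:
  assumes "z \<in> upper_half_plane"
  shows "(matrix_kernel N z)\<^sup>2 / matrix_kernel M z = matrix_kernel (2 *\<^sub>R N - M) z"
proof -
  have "(matrix_kernel N z)\<^sup>2 = matrix_kernel (2 *\<^sub>R N - M) z * matrix_kernel M z"
    using assms
    by (auto simp: upper_half_plane_def matrix_kernel_def poincare_kernel_def power2_eq_square exp_add[symmetric] field_simps)
  then show ?thesis using matrix_kernel_pos[OF assms, of M] by simp
qed

section \<open>Evaluation of the two divergences\<close>

text \<open>The divergence integrands expand with a negative cross term. Moving it to the other side
  as \<open>g\<close> keeps all integrals in \<open>ennreal\<close>; its finite integral is
  subtracted only at the end, in \<open>ereal\<close>, so an infinite integral of \<open>h\<close>
  is covered too.\<close>

lemma f_divergence_eq_diff: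
  assumes [measurable]: "f \<in> borel_measurable borel" "p \<in> borel_measurable borel"
      "q \<in> borel_measurable borel" "g \<in> borel_measurable borel"
    and f: "\<And>z. z \<in> upper_half_plane \<Longrightarrow> p z * f (q z / p z) \<ge> 0"
    and g: "\<And>z. z \<in> upper_half_plane \<Longrightarrow> g z \<ge> 0"
    and h: "\<And>z. z \<in> upper_half_plane \<Longrightarrow> p z * f (q z / p z) + g z = h z"
    and G: "(\<integral>\<^sup>+z\<in>upper_half_plane. ennreal (g z) \<partial>lborel) = ennreal G" "G \<ge> 0"
  shows "f_divergence f p q
    = enn2ereal (\<integral>\<^sup>+z\<in>upper_half_plane. ennreal (h z) \<partial>lborel) - ereal G"
proof -
  let ?F = "\<lambda>z. p z * f (q z / p z)"
  have neg: "(\<integral>\<^sup>+z\<in>upper_half_plane. ennreal (- ?F z) \<partial>lborel) = 0"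
    by (rule nn_integral_zero') (auto simp: f ennreal_neg split: split_indicator)
  have "(\<integral>\<^sup>+z\<in>upper_half_plane. ennreal (?F z) \<partial>lborel) + ennreal G
      = (\<integral>\<^sup>+z. ennreal (?F z) * indicator upper_half_plane z
          + ennreal (g z) * indicator upper_half_plane z \<partial>lborel)"
    unfolding G(1)[symmetric] by (rule nn_integral_add[symmetric]) auto
  also have "\<dots> = (\<integral>\<^sup>+z\<in>upper_half_plane. ennreal (h z) \<partial>lborel)"
    by (intro nn_integral_cong) (auto simp: f g h[symmetric] split: split_indicator)
  finally have "enn2ereal (\<integral>\<^sup>+z\<in>upper_half_plane. ennreal (?F z) \<partial>lborel) + ereal G
      = enn2ereal (\<integral>\<^sup>+z\<in>upper_half_plane. ennreal (h z) \<partial>lborel)"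
    using G(2) by (simp add: plus_ennreal.rep_eq[symmetric] enn2ereal_ennreal[symmetric] del: enn2ereal_ennreal)
  \<comment> \<open>Legitimate also for infinite x, because G is a finite real.\<close>
  moreover have "x = y - ereal G" if "x + ereal G = y" for x y
    using that by (cases x) auto
  ultimately have "enn2ereal (\<integral>\<^sup>+z\<in>upper_half_plane. ennreal (?F z) \<partial>lborel)
      = enn2ereal (\<integral>\<^sup>+z\<in>upper_half_plane. ennreal (h z) \<partial>lborel) - ereal G"
    by blast
  then show ?thesis
    by (simp add: f_divergence_def neg zero_ennreal.rep_eq)
qed

text \<open>Expanding the square gives (p + q) / 2 - sqrt (pq), so the divergence is 1 minus the
  Bhattacharyya coefficient, an integral of the kernel of (M + N) / 2.\<close>

lemma f_divergence_squared_Hellinger: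
  fixes M N :: "real ^ 2 ^ 2"
  assumes M: "M \<in> sym_pos_def" and N: "N \<in> sym_pos_def"
  shows "f_divergence (\<lambda>u. (sqrt u - 1)\<^sup>2 / 2) (poincare_density M) (poincare_density N) =
       ereal (1 - 2 * det M powr (1/4) * det N powr (1/4) * exp (det M powr (1/2) + det N powr (1/2))
                  / (det (M + N) powr (1/2) * exp (det (M + N) powr (1/2))))"
proof -
  let ?p = "poincare_density M" and ?q = "poincare_density N" and ?S = "(1/2) *\<^sub>R (M + N)"
  let ?k = "sqrt (poincare_normalizer M * poincare_normalizer N)"
  let ?G = "?k * (pi * exp (- 2 * sqrt (det ?S)) / sqrt (det ?S))"
  have dM: "det M > 0" and dN: "det N > 0"
    using M N by (auto simp: sym_pos_def_2_iff)
  have "M + N \<in> sym_pos_def"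
    using M N by (auto simp: sym_pos_def_def matrix_vector_mult_add_rdistrib inner_add_right
        add_pos_pos transpose_def vec_eq_iff)
  then have dS: "det (M + N) > 0" and S: "?S \<in> sym_pos_def"
    by (auto simp: sym_pos_def_2_iff det_2)
  have k: "?k > 0"
    using poincare_normalizer_pos[OF M] poincare_normalizer_pos[OF N] by simp
  \<comment> \<open>Halving a 2 by 2 matrix quarters its determinant. Its root is therefore halved,
    which produces the factor 2 in the numerator and removes the 2 from the exponent.\<close>
  have det: "det ?S = det (M + N) / 4"
    by (simp add: det_2 field_simps)
  have "f_divergence (\<lambda>u. (sqrt u - 1)\<^sup>2 / 2) ?p ?q
      = enn2ereal (\<integral>\<^sup>+z\<in>upper_half_plane. ennreal (?p z / 2 + ?q z / 2) \<partial>lborel) - ereal ?G"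
  proof (rule f_divergence_eq_diff[where g = "\<lambda>z. sqrt (?p z * ?q z)"])
    fix z assume z: "z \<in> upper_half_plane"
    have p: "?p z > 0" and q: "?q z > 0"
      using z M N by (auto intro: poincare_density_pos)
    show "?p z * ((sqrt (?q z / ?p z) - 1)\<^sup>2 / 2) \<ge> 0" "sqrt (?p z * ?q z) \<ge> 0"
      using p q by auto
    have "?p z * sqrt (?q z / ?p z) = sqrt (?p z * ?q z)"
      using p q by (simp add: real_sqrt_divide real_sqrt_mult real_div_sqrt flip: times_divide_eq_left)
    then show "?p z * ((sqrt (?q z / ?p z) - 1)\<^sup>2 / 2) + sqrt (?p z * ?q z) = ?p z / 2 + ?q z / 2"
      using p q by (simp add: power2_diff field_simps)
  next
    have "(\<integral>\<^sup>+z\<in>upper_half_plane. ennreal (sqrt (?p z * ?q z)) \<partial>lborel)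
        = (\<integral>\<^sup>+z\<in>upper_half_plane. ennreal (?k * matrix_kernel ?S z) \<partial>lborel)"
      by (intro nn_integral_cong)
        (simp add: poincare_density_kernel matrix_kernel_sqrt_mult[symmetric] real_sqrt_mult[symmetric] mult_ac split: split_indicator)
    also have "\<dots> = ennreal ?G"
    proof (subst nn_integral_matrix_kernel)
      show "?S $ 1 $ 2 = ?S $ 2 $ 1" using S by (simp add: sym_pos_def_2_iff)
      show "ennreal ?k * (if ?S \<in> sym_pos_def then ennreal (pi * exp (- 2 * sqrt (det ?S)) / sqrt (det ?S)) else \<infinity>)
          = ennreal ?G"
        using S k dS by (subst ennreal_mult) (simp_all add: det)
    qed (use k in simp)
    finally show "(\<integral>\<^sup>+z\<in>upper_half_plane. ennreal (sqrt (?p z * ?q z)) \<partial>lborel) = ennreal ?G" .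
    show "?G \<ge> 0" using k dS by (simp add: det)
  qed measurable
  also have "(\<integral>\<^sup>+z\<in>upper_half_plane. ennreal (?p z / 2 + ?q z / 2) \<partial>lborel) = 1"
  proof -
    have "(\<integral>\<^sup>+z\<in>upper_half_plane. ennreal (?p z / 2 + ?q z / 2) \<partial>lborel)
        = (\<integral>\<^sup>+z. ennreal (1/2) * (ennreal (?p z) * indicator upper_half_plane z)
            + ennreal (1/2) * (ennreal (?q z) * indicator upper_half_plane z) \<partial>lborel)"
    proof (intro nn_integral_cong)
      fix z
      have "ennreal (x / 2 + y / 2) = ennreal (1/2) * ennreal x + ennreal (1/2) * ennreal y"
        if "x > 0" "y > 0" for x y
        using that by (simp only: ennreal_mult[symmetric] ennreal_plus[symmetric]) simp
      then show "ennreal (?p z / 2 + ?q z / 2) * indicator upper_half_plane z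
          = ennreal (1/2) * (ennreal (?p z) * indicator upper_half_plane z)
            + ennreal (1/2) * (ennreal (?q z) * indicator upper_half_plane z)"
        using poincare_density_pos[OF M] poincare_density_pos[OF N]
        by (cases "z \<in> upper_half_plane") (simp_all only: indicator_simps mult_1_right mult_zero_right add_0 not_False_eq_True)
    qed
    also have "\<dots> = ennreal (1/2) + ennreal (1/2)"
      by (simp add: nn_integral_add nn_integral_cmult nn_integral_poincare_density M N)
    also have "\<dots> = 1" by (subst ennreal_plus[symmetric]) simp_all
    finally show ?thesis .
  qed
  also have "enn2ereal 1 - ereal ?G = ereal (1 - ?G)"
    by (simp add: one_ennreal.rep_eq one_ereal_def)
  also have "?G = 2 * det M powr (1/4) * det N powr (1/4) * exp (det M powr (1/2) + det N powr (1/2))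
      / (det (M + N) powr (1/2) * exp (det (M + N) powr (1/2)))"
  proof -
    have quarter: "x powr (1/4) = sqrt (sqrt x)" if "x > 0" for x :: real
      using that by (simp add: powr_half_sqrt[symmetric] powr_powr)
    have sqrt_exp: "sqrt (exp (2 * x)) = exp x" for x :: real
      by (simp add: exp_double)
    have "?k = sqrt (sqrt (det M)) * sqrt (sqrt (det N)) * exp (sqrt (det M) + sqrt (det N)) / pi"
      by (simp add: poincare_normalizer_def real_sqrt_mult real_sqrt_divide sqrt_exp exp_add)
    moreover have "sqrt (det ?S) = sqrt (det (M + N)) / 2"
      by (simp add: det real_sqrt_divide)
    ultimately have "?G = sqrt (sqrt (det M)) * sqrt (sqrt (det N)) * exp (sqrt (det M) + sqrt (det N)) / pi
        * (pi * exp (- 2 * (sqrt (det (M + N)) / 2)) / (sqrt (det (M + N)) / 2))"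
      by (simp only:)
    then show ?thesis
      using dM dN dS by (simp only:) (simp add: quarter powr_half_sqrt exp_minus field_simps)
  qed
  finally show ?thesis .
qed

text \<open>The integrand is q^2 / p - 2q + p. The last two terms integrate to -2 and 1, and q^2 / p
  is a positive multiple of the kernel of 2N - M, whose integral is finite exactly when that matrix
  is positive definite.\<close>

lemma f_divergence_Neyman_chi_squared:
  fixes M N :: "real ^ 2 ^ 2"
  assumes M: "M \<in> sym_pos_def" and N: "N \<in> sym_pos_def"
  shows "f_divergence (\<lambda>u. (u - 1)\<^sup>2) (poincare_density M) (poincare_density N) =
       (if 2 *\<^sub>R N - M \<in> sym_pos_def
        then ereal (det N * exp (4 * det N powr (1/2))
                    / (det M powr (1/2) * det (2 *\<^sub>R N - M) powr (1/2)
                       * exp (2 * (det M powr (1/2) + det (2 *\<^sub>R N - M) powr (1/2)))) - 1)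
        else \<infinity>)"
proof -
  let ?p = "poincare_density M" and ?q = "poincare_density N" and ?D = "2 *\<^sub>R N - M"
  let ?k = "(poincare_normalizer N)\<^sup>2 / poincare_normalizer M"
  have dM: "det M > 0" and dN: "det N > 0" and sym: "?D $ 1 $ 2 = ?D $ 2 $ 1"
    using M N by (auto simp: sym_pos_def_2_iff)
  have k: "?k > 0"
    using poincare_normalizer_pos[OF M] poincare_normalizer_pos[OF N] by simp
  have "f_divergence (\<lambda>u. (u - 1)\<^sup>2) ?p ?q
      = enn2ereal (\<integral>\<^sup>+z\<in>upper_half_plane. ennreal (?k * matrix_kernel ?D z + ?p z) \<partial>lborel) - ereal 2"
  proof (rule f_divergence_eq_diff[where g = "\<lambda>z. 2 * ?q z"])
    fix z assume z: "z \<in> upper_half_plane"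
    have p: "?p z > 0" and q: "?q z > 0"
      using z M N by (auto intro: poincare_density_pos)
    show "?p z * (?q z / ?p z - 1)\<^sup>2 \<ge> 0" "2 * ?q z \<ge> 0"
      using p q by auto
    have "?k * matrix_kernel ?D z = (?q z)\<^sup>2 / ?p z"
      unfolding matrix_kernel_square_divide[OF z, symmetric] poincare_density_kernel
      by (simp add: power_mult_distrib)
    then show "?p z * (?q z / ?p z - 1)\<^sup>2 + 2 * ?q z = ?k * matrix_kernel ?D z + ?p z"
      using p q by (simp add: power2_eq_square field_simps)
  next
    have "(\<integral>\<^sup>+z\<in>upper_half_plane. ennreal (2 * ?q z) \<partial>lborel)
        = ennreal 2 * (\<integral>\<^sup>+z\<in>upper_half_plane. ennreal (?q z) \<partial>lborel)"
      by (subst nn_integral_cmult[symmetric]) (auto simp: ennreal_mult' mult.assoc)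
    then show "(\<integral>\<^sup>+z\<in>upper_half_plane. ennreal (2 * ?q z) \<partial>lborel) = ennreal 2"
      by (simp add: nn_integral_poincare_density N)
  qed simp_all
  also have "(\<integral>\<^sup>+z\<in>upper_half_plane. ennreal (?k * matrix_kernel ?D z + ?p z) \<partial>lborel)
      = ennreal ?k * (if ?D \<in> sym_pos_def then ennreal (pi * exp (- 2 * sqrt (det ?D)) / sqrt (det ?D)) else \<infinity>) + 1"
    (is "_ = ?X + 1")
  proof -
    have "(\<integral>\<^sup>+z\<in>upper_half_plane. ennreal (?k * matrix_kernel ?D z + ?p z) \<partial>lborel)
        = (\<integral>\<^sup>+z. ennreal (?k * matrix_kernel ?D z) * indicator upper_half_plane z
            + ennreal (?p z) * indicator upper_half_plane z \<partial>lborel)"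
    proof (intro nn_integral_cong)
      fix z
      have "ennreal (?k * matrix_kernel ?D z + ?p z) = ennreal (?k * matrix_kernel ?D z) + ennreal (?p z)"
        if z: "z \<in> upper_half_plane"
        using poincare_density_pos[OF M z] matrix_kernel_pos[OF z, of ?D] k
        by (intro ennreal_plus mult_nonneg_nonneg less_imp_le)
      then show "ennreal (?k * matrix_kernel ?D z + ?p z) * indicator upper_half_plane z
          = ennreal (?k * matrix_kernel ?D z) * indicator upper_half_plane z
            + ennreal (?p z) * indicator upper_half_plane z"
        by (cases "z \<in> upper_half_plane") (simp_all only: indicator_simps mult_1_right mult_zero_right add_0 not_False_eq_True)
    qed
    also have "\<dots> = (\<integral>\<^sup>+z\<in>upper_half_plane. ennreal (?k * matrix_kernel ?D z) \<partial>lborel)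
        + (\<integral>\<^sup>+z\<in>upper_half_plane. ennreal (?p z) \<partial>lborel)"
      by (rule nn_integral_add) auto
    also have "\<dots> = ?X + 1"
      by (simp only: nn_integral_matrix_kernel[OF sym less_imp_le[OF k]] nn_integral_poincare_density[OF M])
    finally show ?thesis .
  qed
  finally have *: "f_divergence (\<lambda>u. (u - 1)\<^sup>2) ?p ?q = enn2ereal (?X + 1) - ereal 2" .
  show ?thesis
  proof (cases "?D \<in> sym_pos_def")
    case True
    then have dD: "det ?D > 0" by (simp add: sym_pos_def_2_iff)
    let ?e = "pi * exp (- 2 * sqrt (det ?D)) / sqrt (det ?D)"
    let ?x = "?k * ?e"
    have e: "?e \<ge> 0" using dD by simp
    have "?X + 1 = ennreal ?x + ennreal 1"
      using True k e by (simp only: if_True ennreal_mult less_imp_le ennreal_1)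
    also have "\<dots> = ennreal (?x + 1)"
      using k e by (intro ennreal_plus[symmetric] mult_nonneg_nonneg) simp_all
    finally have "enn2ereal (?X + 1) = ereal (?x + 1)"
      using mult_nonneg_nonneg[OF less_imp_le[OF k] e] by (simp only: enn2ereal_ennreal)
    then have "enn2ereal (?X + 1) - ereal 2 = ereal (?x - 1)"
      by (simp only: ereal_minus) simp
    moreover have "?x = det N * exp (4 * det N powr (1/2))
        / (det M powr (1/2) * det ?D powr (1/2) * exp (2 * (det M powr (1/2) + det ?D powr (1/2))))"
    proof -
      have "(poincare_normalizer N)\<^sup>2 = det N * exp (4 * sqrt (det N)) / pi\<^sup>2"
        using dN by (simp add: poincare_normalizer_def power_mult_distrib power_divide flip: exp_of_nat_mult)
      then show ?thesis
        using dM dN dD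
        by (simp add: poincare_normalizer_def[of M] powr_half_sqrt exp_minus exp_add distrib_left field_simps power2_eq_square)
    qed
    ultimately show ?thesis using True * by simp
  next
    case False
    \<comment> \<open>The normalising factor is strictly positive, so its product with infinity is
      not the degenerate 0 times infinity.\<close>
    then have "?X = \<infinity>"
      using poincare_normalizer_pos[OF M] poincare_normalizer_pos[OF N] by (simp add: ennreal_mult_top)
    with False * show ?thesis by simp
  qed
qed

theorem proposition3:
  fixes \<theta> \<theta>' :: "real ^ 2 ^ 2"
  assumes "\<theta> \<in> sym_pos_def" and "\<theta>' \<in> sym_pos_def"
  shows
    "f_divergence (\<lambda>u. (sqrt u - 1)\<^sup>2 / 2) (poincare_density \<theta>) (poincare_density \<theta>') =
       ereal (1 - 2 * det \<theta> powr (1/4) * det \<theta>' powr (1/4)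
                    * exp (det \<theta> powr (1/2) + det \<theta>' powr (1/2))
                  / (det (\<theta> + \<theta>') powr (1/2) * exp (det (\<theta> + \<theta>') powr (1/2))))
     \<and>
     f_divergence (\<lambda>u. (u - 1)\<^sup>2) (poincare_density \<theta>) (poincare_density \<theta>') =
       (if 2 *\<^sub>R \<theta>' - \<theta> \<in> sym_pos_def
        then ereal (det \<theta>' * exp (4 * det \<theta>' powr (1/2))
                    / (det \<theta> powr (1/2) * det (2 *\<^sub>R \<theta>' - \<theta>) powr (1/2)
                       * exp (2 * (det \<theta> powr (1/2) + det (2 *\<^sub>R \<theta>' - \<theta>) powr (1/2))))
                    - 1)
        else \<infinity>)"
  using assms by (intro conjI f_divergence_squared_Hellinger f_divergence_Neyman_chi_squared)

end
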